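(* Consider the bases $[3021]$ (elements $A^{\downarrow\downarrow}_i,B^{\downarrow\downarrow}_i,\psi^{\downarrow\downarrow}_{i+1}$, $i\in\mathbb{N}$) and $[3012]$ (elements $A^{\uparrow\downarrow}_i,B^{\uparrow\downarrow}_i,\psi^{\uparrow\downarrow}_{i+1}$, $i\in\mathbb{N}$) of the Onsager Lie algebra $O$. The transition matrix from $[3021]$ to $[3012]$ is given, for $i\in\mathbb{N}$, by $$\begin{aligned} A^{\uparrow\downarrow}_i&=(-1)^{i+1}\sum_{j=0}^i\binom{i}{j}A^{\downarrow\downarrow}_j,\\ B^{\uparrow\downarrow}_i&=(-1)^i\sum_{j=0}^i\binom{i}{j}B^{\downarrow\downarrow}_j,\\ \psi^{\uparrow\downarrow}_{i+1}&=(-1)^i\sum_{j=0}^i\binom{i}{j}B^{\downarrow\downarrow}_j+(-1)^{i+1}\sum_{j=0}^i\binom{i}{j}\psi^{\downarrow\downarrow}_{j+1}. \end{aligned}$$ Moreover, the transition matrix from $[3012]$ to $[3021]$ is given, for $i\in\mathbb{N}$, by $$\begin{aligned} A^{\downarrow\downarrow}_i&=(-1)^{i+1}\sum_{j=0}^i\binom{i}{j}A^{\uparrow\downarrow}_j,\\ B^{\downarrow\downarrow}_i&=(-1)^i\sum_{j=0}^i\binom{i}{j}B^{\uparrow\downarrow}_j,\\ \psi^{\downarrow\downarrow}_{i+1}&=(-1)^i\sum_{j=0}^i\binom{i}{j}B^{\uparrow\downarrow}_j+(-1)^{i+1}\sum_{j=0}^i\binom{i}{j}\psi^{\uparrow\downarrow}_{j+1}.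 \end{aligned}$$
   Context: $\mathbb{F}$ is a field of characteristic zero; $\mathbb{N}=\{0,1,2,\ldots\}$; tensor products are over $\mathbb{F}$. $\mathfrak{sl}_2$ is the Lie algebra over $\mathbb{F}$ with basis $e,f,h$ and $[h,e]=2e$, $[h,f]=-2f$, $[e,f]=h$; $x=2e-h$, $y=-2f-h$, $z=h$ is its equitable basis. $\mathcal{A}=\mathbb{F}[t,t^{-1},(t-1)^{-1}]$ with $t$ an indeterminate. $L(\mathfrak{sl}_2)^+=\mathfrak{sl}_2\otimes\mathcal{A}$ with Lie bracket $[u\otimes a,v\otimes b]=[u,v]\otimes ab$ and right $\mathcal{A}$-module structure $(u\otimes a)b=u\otimes ab$. The Onsager Lie algebra $O$ (generators $A,B$; relations $[A,[A,[A,B]]]=4[A,B]$, $[B,[B,[B,A]]]=4[B,A]$) is identified with the Lie subalgebra of $L(\mathfrak{sl}_2)^+$ generated by $A=x\otimes1$ and $B=y\otimes t+z\otimes(t-1)$. Bases of $O$ (indexed by $i\in\mathbb{N}$): $[3021]$: $A^{\downarrow\downarrow}_i=-x\otimes(t-1)^i$, $B^{\downarrow\downarrow}_i=(-y\otimes t-z\otimes(t-1))(t-1)^i$, $\psi^{\downarrow\downarrow}_{i+1}=(-x\otimes1-y\otimes t)(t-1)^i$. $[3012]$: $A^{\uparrow\downarrow}_i=x\otimes(-t)^i$, $B^{\uparrow\downarrow}_i=(-y\otimes t-z\otimes(t-1))(-t)^i$, $\psi^{\uparrow\downarrow}_{i+1}=(x\otimes1-z\otimes(t-1))(-t)^i$.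 The transition matrix from one basis to another is described by expressing each element of the second basis as a linear combination of the elements of the first. *)

theory Defs
  imports "HOL-Computational_Algebra.Polynomial_Factorial"
begin

section \<open>The Lie algebra $sl_2$\<close>

text \<open>
  \<open>'r sl2\<close> is the free \<open>'r\<close>-module on \<open>e, f, h\<close>, represented by coordinates, with the bracket
  that extends \<open>[h,e] = 2e\<close>, \<open>[h,f] = -2f\<close>, \<open>[e,f] = h\<close> bilinearly over \<open>'r\<close>.  For a field
  \<open>'k\<close> this is $sl_2$ over \<open>'k\<close>; for a commutative \<open>'k\<close>-algebra \<open>'r\<close> it is the tensor product of
  $sl_2$ over \<open>'k\<close> with \<open>'r\<close> (extension of scalars).
\<close>

datatype 'r sl2 = SL2 (e_coord: 'r) (f_coord: 'r) (h_coord: 'r)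

instantiation sl2 :: (ab_group_add) ab_group_add
begin

definition zero_sl2 :: "'a sl2" where
  "0 = SL2 0 0 0"

definition plus_sl2 :: "'a sl2 \<Rightarrow> 'a sl2 \<Rightarrow> 'a sl2" where
  "u + v = SL2 (e_coord u + e_coord v) (f_coord u + f_coord v) (h_coord u + h_coord v)"

definition minus_sl2 :: "'a sl2 \<Rightarrow> 'a sl2 \<Rightarrow> 'a sl2" where
  "u - v = SL2 (e_coord u - e_coord v) (f_coord u - f_coord v) (h_coord u - h_coord v)"

definition uminus_sl2 :: "'a sl2 \<Rightarrow> 'a sl2" where
  "- u = SL2 (- e_coord u) (- f_coord u) (- h_coord u)"

instance
  by standard
    (simp_all add: zero_sl2_def plus_sl2_def minus_sl2_def uminus_sl2_def algebra_simps)

end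

lemma sl2_coord_simps [simp]:
  "e_coord 0 = 0" "f_coord 0 = 0" "h_coord 0 = 0"
  "e_coord (u + v) = e_coord u + e_coord v"
  "f_coord (u + v) = f_coord u + f_coord v"
  "h_coord (u + v) = h_coord u + h_coord v"
  "e_coord (u - v) = e_coord u - e_coord v"
  "f_coord (u - v) = f_coord u - f_coord v"
  "h_coord (u - v) = h_coord u - h_coord v"
  "e_coord (- u) = - e_coord u" "f_coord (- u) = - f_coord u" "h_coord (- u) = - h_coord u"
  by (simp_all add: zero_sl2_def plus_sl2_def minus_sl2_def uminus_sl2_def)

definition sl2_scale :: "'r::comm_ring_1 \<Rightarrow> 'r sl2 \<Rightarrow> 'r sl2" where
  "sl2_scale c u = SL2 (c * e_coord u) (c * f_coord u) (c * h_coord u)"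

definition lie_bracket :: "'r::comm_ring_1 sl2 \<Rightarrow> 'r sl2 \<Rightarrow> 'r sl2" where
  "lie_bracket u v = SL2
     (2 * (h_coord u * e_coord v - e_coord u * h_coord v))
     (- 2 * (h_coord u * f_coord v - f_coord u * h_coord v))
     (e_coord u * f_coord v - f_coord u * e_coord v)"

definition sl2_e :: "'r::comm_ring_1 sl2" where "sl2_e = SL2 1 0 0"
definition sl2_f :: "'r::comm_ring_1 sl2" where "sl2_f = SL2 0 1 0"
definition sl2_h :: "'r::comm_ring_1 sl2" where "sl2_h = SL2 0 0 1"

definition sl2_x :: "'r::comm_ring_1 sl2" where "sl2_x = sl2_scale 2 sl2_e - sl2_h"
definition sl2_y :: "'r::comm_ring_1 sl2" where "sl2_y = sl2_scale (- 2) sl2_f - sl2_h"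
definition sl2_z :: "'r::comm_ring_1 sl2" where "sl2_z = sl2_h"

lemma lie_bracket_efh:
  "lie_bracket sl2_h sl2_e = sl2_scale 2 sl2_e"
  "lie_bracket sl2_h sl2_f = sl2_scale (- 2) sl2_f"
  "lie_bracket sl2_e sl2_f = sl2_h"
  by (simp_all add: lie_bracket_def sl2_scale_def sl2_e_def sl2_f_def sl2_h_def)

lemma lie_bracket_bilinear:
  "lie_bracket (u + v) w = lie_bracket u w + lie_bracket v w"
  "lie_bracket w (u + v) = lie_bracket w u + lie_bracket w v"
  "lie_bracket (sl2_scale c u) w = sl2_scale c (lie_bracket u w)"
  "lie_bracket w (sl2_scale c u) = sl2_scale c (lie_bracket w u)"
  by (simp_all add: lie_bracket_def sl2_scale_def plus_sl2_def algebra_simps)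

lemma lie_bracket_self: "lie_bracket u u = 0"
  by (simp add: lie_bracket_def zero_sl2_def)

lemma lie_bracket_jacobi:
  "lie_bracket u (lie_bracket v w) + lie_bracket v (lie_bracket w u)
     + lie_bracket w (lie_bracket u v) = 0"
  by (simp add: lie_bracket_def zero_sl2_def plus_sl2_def algebra_simps)


section \<open>The algebra $F[t, t^{-1}, (t-1)^{-1}]$\<close>

text \<open>Realised inside the field of rational functions, as the fractions whose denominator is
  $t^m (t-1)^n$.\<close>

definition coord_carrier :: "'k::field poly fract set" where
  "coord_carrier = {Fract p ([:0, 1:] ^ m * [:- 1, 1:] ^ n) | p m n. True}"

lemma coord_denom_nonzero [simp]:
  "([:0, 1:] :: 'k::field poly) ^ m * [:- 1, 1:] ^ n \<noteq> 0"
  by simp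

lemma coord_carrierI: "Fract p ([:0, 1:] ^ m * [:- 1, 1:] ^ n) \<in> coord_carrier"
  unfolding coord_carrier_def by blast

lemma to_fract_in_coord_carrier: "to_fract p \<in> coord_carrier"
  using coord_carrierI[of p 0 0] by (simp add: to_fract_def)

typedef (overloaded) 'k coord_alg = "coord_carrier :: 'k::field poly fract set"
  using to_fract_in_coord_carrier by blast

setup_lifting type_definition_coord_alg

lemma coord_carrier_mult:
  assumes "a \<in> coord_carrier" "b \<in> coord_carrier"
  shows "a * b \<in> coord_carrier"
proof -
  from assms obtain p m n q k l
    where a: "a = Fract p ([:0, 1:] ^ m * [:- 1, 1:] ^ n)"
      and b: "b = Fract q ([:0, 1:] ^ k * [:- 1, 1:] ^ l)"
    unfolding coord_carrier_def by blast
  have "a * b = Fract (p * q) ([:0, 1:] ^ (m + k) * [:- 1, 1:] ^ (n + l))"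
    unfolding a b mult_fract by (simp only: power_add ac_simps)
  then show ?thesis using coord_carrierI by simp
qed

lemma coord_carrier_uminus:
  assumes "a \<in> coord_carrier"
  shows "- a \<in> coord_carrier"
  using coord_carrier_mult[OF to_fract_in_coord_carrier[of "- 1"] assms] by simp

lemma coord_carrier_add:
  assumes "a \<in> coord_carrier" "b \<in> coord_carrier"
  shows "a + b \<in> coord_carrier"
proof -
  from assms obtain p m n q k l
    where a: "a = Fract p ([:0, 1:] ^ m * [:- 1, 1:] ^ n)"
      and b: "b = Fract q ([:0, 1:] ^ k * [:- 1, 1:] ^ l)"
    unfolding coord_carrier_def by blast
  have "a + b = Fract (p * ([:0, 1:] ^ k * [:- 1, 1:] ^ l) + q * ([:0, 1:] ^ m * [:- 1, 1:] ^ n))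
      ([:0, 1:] ^ (m + k) * [:- 1, 1:] ^ (n + l))"
    unfolding a b add_fract[OF coord_denom_nonzero coord_denom_nonzero]
    by (simp only: power_add ac_simps)
  then show ?thesis using coord_carrierI by simp
qed

lemma coord_carrier_diff:
  assumes "a \<in> coord_carrier" "b \<in> coord_carrier"
  shows "a - b \<in> coord_carrier"
  using coord_carrier_add[OF assms(1) coord_carrier_uminus[OF assms(2)]] by simp

instantiation coord_alg :: (field) comm_ring_1
begin

lift_definition zero_coord_alg :: "'a coord_alg" is 0
  using to_fract_in_coord_carrier[of 0] by simp
lift_definition one_coord_alg :: "'a coord_alg" is 1
  using to_fract_in_coord_carrier[of 1] by simp
lift_definition plus_coord_alg :: "'a coord_alg \<Rightarrow> 'a coord_alg \<Rightarrow> 'a coord_alg" is "(+)"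
  by (rule coord_carrier_add)
lift_definition minus_coord_alg :: "'a coord_alg \<Rightarrow> 'a coord_alg \<Rightarrow> 'a coord_alg" is "(-)"
  by (rule coord_carrier_diff)
lift_definition uminus_coord_alg :: "'a coord_alg \<Rightarrow> 'a coord_alg" is uminus
  by (rule coord_carrier_uminus)
lift_definition times_coord_alg :: "'a coord_alg \<Rightarrow> 'a coord_alg \<Rightarrow> 'a coord_alg" is "(*)"
  by (rule coord_carrier_mult)

instance
  by standard (transfer; simp add: algebra_simps)+

end

lift_definition coord_t :: "'k::field coord_alg" is "to_fract [:0, 1:]"
  by (rule to_fract_in_coord_carrier)

lift_definition coord_const :: "'k::field \<Rightarrow> 'k coord_alg" is "\<lambda>c. to_fract [:c:]"
  by (rule to_fract_in_coord_carrier)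

lemma coord_const_hom:
  "coord_const 0 = 0" "coord_const 1 = 1"
  "coord_const (a + b) = coord_const a + coord_const b"
  "coord_const (a * b) = coord_const a * coord_const b"
proof -
  show "coord_const 0 = 0" "coord_const 1 = 1"
    by (transfer; simp flip: one_pCons)+
  show "coord_const (a + b) = coord_const a + coord_const b"
    by transfer (simp flip: to_fract_add)
  show "coord_const (a * b) = coord_const a * coord_const b"
    by transfer (simp flip: to_fract_mult)
qed

lemma coord_t_unit: "(coord_t :: 'k::field coord_alg) dvd 1"
  and coord_t_minus_1_unit: "(coord_t - 1 :: 'k coord_alg) dvd 1"
proof -
  have *: "Fract 1 [:0, 1:] \<in> coord_carrier" "Fract 1 [:- 1, 1:] \<in> coord_carrier"
    using coord_carrierI[of 1 1 0] coord_carrierI[of 1 0 1] by simp_all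
  have "(coord_t :: 'k coord_alg) * Abs_coord_alg (Fract 1 [:0, 1:]) = 1"
    by (simp add: Rep_coord_alg_inject[symmetric] times_coord_alg.rep_eq one_coord_alg.rep_eq
        coord_t.rep_eq Abs_coord_alg_inverse * to_fract_def One_fract_def eq_fract)
  then show "(coord_t :: 'k coord_alg) dvd 1" by (metis dvdI)
  have "(to_fract [:0, 1:] :: 'k poly fract) - 1 = to_fract [:- 1, 1:]"
    by (simp flip: to_fract_1 to_fract_diff add: one_pCons)
  then have "(coord_t - 1 :: 'k coord_alg) * Abs_coord_alg (Fract 1 [:- 1, 1:]) = 1"
    by (simp add: Rep_coord_alg_inject[symmetric] times_coord_alg.rep_eq one_coord_alg.rep_eq
        minus_coord_alg.rep_eq
        coord_t.rep_eq Abs_coord_alg_inverse * to_fract_def One_fract_def eq_fract)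
  then show "(coord_t - 1 :: 'k coord_alg) dvd 1" by (metis dvdI)
qed

definition coord_scale :: "'k::field \<Rightarrow> 'k coord_alg \<Rightarrow> 'k coord_alg" where
  "coord_scale c a = coord_const c * a"


section \<open>The three-point loop algebra of $sl_2$\<close>

type_synonym 'k loop_sl2 = "'k coord_alg sl2"

definition loop_scale :: "'k::field \<Rightarrow> 'k loop_sl2 \<Rightarrow> 'k loop_sl2" where
  "loop_scale c v = sl2_scale (coord_const c) v"

definition tensor :: "'k::field sl2 \<Rightarrow> 'k coord_alg \<Rightarrow> 'k loop_sl2"  (infix \<open>\<otimes>\<close> 72) where
  "u \<otimes> a = SL2 (coord_scale (e_coord u) a) (coord_scale (f_coord u) a) (coord_scale (h_coord u) a)"

definition right_act :: "'k::field loop_sl2 \<Rightarrow> 'k coord_alg \<Rightarrow> 'k loop_sl2"  (infixl \<open>\<bullet>\<close> 71) where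
  "v \<bullet> b = SL2 (e_coord v * b) (f_coord v * b) (h_coord v * b)"

global_interpretation sl2_vs: vector_space "sl2_scale :: 'k::field \<Rightarrow> _"
  by standard (simp_all add: sl2_scale_def plus_sl2_def algebra_simps)

global_interpretation coord_vs: vector_space "coord_scale :: 'k::field \<Rightarrow> _"
  by standard (simp_all add: coord_scale_def coord_const_hom algebra_simps)

global_interpretation loop: vector_space "loop_scale :: 'k::field \<Rightarrow> _"
  by standard
    (simp_all add: loop_scale_def sl2_scale_def plus_sl2_def coord_const_hom algebra_simps)

lemma tensor_bilinear:
  "(u + v) \<otimes> a = u \<otimes> a + v \<otimes> a"
  "u \<otimes> (a + b) = u \<otimes> a + u \<otimes> b"
  "sl2_scale c u \<otimes> a = loop_scale c (u \<otimes> a)"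
  "u \<otimes> coord_scale c a = loop_scale c (u \<otimes> a)"
  by (simp_all add: tensor_def coord_scale_def loop_scale_def sl2_scale_def plus_sl2_def
      coord_const_hom algebra_simps)

lemma loop_sl2_decompose:
  "v = sl2_e \<otimes> e_coord v + sl2_f \<otimes> f_coord v + sl2_h \<otimes> h_coord v"
  by (cases v) (simp add: tensor_def coord_scale_def coord_const_hom plus_sl2_def
      sl2_e_def sl2_f_def sl2_h_def)

text \<open>The universal property, which identifies \<open>'k loop_sl2\<close> with the tensor product of
  \<open>'k sl2\<close> and \<open>'k coord_alg\<close> over \<open>'k\<close>.\<close>

lemma tensor_universal:
  fixes s :: "'k::field \<Rightarrow> 'c::ab_group_add \<Rightarrow> 'c"
    and \<beta> :: "'k sl2 \<Rightarrow> 'k coord_alg \<Rightarrow> 'c"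
  assumes left: "\<And>a. Vector_Spaces.linear sl2_scale s (\<lambda>u. \<beta> u a)"
    and right: "\<And>u. Vector_Spaces.linear coord_scale s (\<beta> u)"
  shows "\<exists>!g. Vector_Spaces.linear loop_scale s g \<and> (\<forall>u a. g (u \<otimes> a) = \<beta> u a)"
proof (rule ex_ex1I)
  interpret s: vector_space s
    using right[of 0] by (simp add: Vector_Spaces.linear_def)
  note ladd = module_hom.add[OF Vector_Spaces.linear.axioms(3)[OF left]]
    and lscale = module_hom.scale[OF Vector_Spaces.linear.axioms(3)[OF left]]
    and radd = module_hom.add[OF Vector_Spaces.linear.axioms(3)[OF right]]
    and rscale = module_hom.scale[OF Vector_Spaces.linear.axioms(3)[OF right]]
  define g where "g v = \<beta> sl2_e (e_coord v) + \<beta> sl2_f (f_coord v) + \<beta> sl2_h (h_coord v)"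
    for v :: "'k loop_sl2"
  have "Vector_Spaces.linear loop_scale s g"
  proof unfold_locales
    fix v w and c :: 'k
    show "g (v + w) = g v + g w"
      by (simp add: g_def radd)
    have "coord_const c * a = coord_scale c a" for a
      by (simp add: coord_scale_def)
    then show "g (loop_scale c v) = s c (g v)"
      by (simp add: g_def loop_scale_def sl2_scale_def rscale s.scale_right_distrib)
  qed
  moreover have "g (u \<otimes> a) = \<beta> u a" for u a
  proof -
    have "u = sl2_scale (e_coord u) sl2_e + sl2_scale (f_coord u) sl2_f
        + sl2_scale (h_coord u) sl2_h"
      by (cases u) (simp add: sl2_scale_def plus_sl2_def sl2_e_def sl2_f_def sl2_h_def)
    then have "\<beta> u a = \<beta> (sl2_scale (e_coord u) sl2_e + sl2_scale (f_coord u) sl2_f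
        + sl2_scale (h_coord u) sl2_h) a"
      by simp
    then show ?thesis
      by (simp add: ladd lscale g_def tensor_def rscale)
  qed
  ultimately show "\<exists>g. Vector_Spaces.linear loop_scale s g \<and> (\<forall>u a. g (u \<otimes> a) = \<beta> u a)"
    by blast
next
  fix g g'
  assume g: "Vector_Spaces.linear loop_scale s g \<and> (\<forall>u a. g (u \<otimes> a) = \<beta> u a)"
    and g': "Vector_Spaces.linear loop_scale s g' \<and> (\<forall>u a. g' (u \<otimes> a) = \<beta> u a)"
  note gadd = module_hom.add[OF Vector_Spaces.linear.axioms(3)[OF conjunct1[OF g]]]
    and gadd' = module_hom.add[OF Vector_Spaces.linear.axioms(3)[OF conjunct1[OF g']]]
  show "g = g'"
  proof
    fix v
    show "g v = g' v"
      using g g' by (subst (1 2) loop_sl2_decompose[of v]) (simp add: gadd gadd')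
  qed
qed

lemma coord_const_uminus: "coord_const (- a) = - coord_const a"
  by (rule minus_unique[symmetric]) (simp flip: coord_const_hom(3) add: coord_const_hom(1))

lemma coord_const_diff: "coord_const (a - b) = coord_const a - coord_const b"
  using coord_const_hom(3)[of a "- b"] by (simp add: coord_const_uminus)

lemma coord_const_numeral: "coord_const (numeral n) = numeral n"
proof -
  have "coord_const (of_nat m) = (of_nat m :: 'a coord_alg)" for m
    by (induction m) (simp_all add: coord_const_hom)
  from this[of "numeral n"] show ?thesis by simp
qed

lemmas coord_const_simps =
  coord_const_hom coord_const_uminus coord_const_diff coord_const_numeral

lemma lie_bracket_tensor:
  "lie_bracket (u \<otimes> a) (v \<otimes> b) = lie_bracket u v \<otimes> (a * b)"
  by (simp add: lie_bracket_def tensor_def coord_scale_def coord_const_simps algebra_simps)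

lemma right_act_tensor: "(u \<otimes> a) \<bullet> b = u \<otimes> (a * b)"
  by (simp add: right_act_def tensor_def coord_scale_def mult.assoc)


section \<open>The Onsager Lie algebra\<close>

definition lie_subalgebra :: "'k::field loop_sl2 set \<Rightarrow> bool" where
  "lie_subalgebra S \<longleftrightarrow> loop.subspace S \<and> (\<forall>u\<in>S. \<forall>v\<in>S. lie_bracket u v \<in> S)"

definition onsager_A :: "'k::field loop_sl2" where
  "onsager_A = sl2_x \<otimes> 1"

definition onsager_B :: "'k::field loop_sl2" where
  "onsager_B = sl2_y \<otimes> coord_t + sl2_z \<otimes> (coord_t - 1)"

definition onsager :: "'k::field loop_sl2 set" where
  "onsager = lie_subalgebra hull {onsager_A, onsager_B}"

lemma lie_subalgebra_onsager: "lie_subalgebra onsager"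
  unfolding onsager_def
  by (rule hull_in) (auto simp: lie_subalgebra_def intro!: loop.subspace_Inter)


lemma onsager_relations:
  "lie_bracket onsager_A (lie_bracket onsager_A (lie_bracket onsager_A onsager_B))
     = loop_scale 4 (lie_bracket onsager_A onsager_B)"
  "lie_bracket onsager_B (lie_bracket onsager_B (lie_bracket onsager_B onsager_A))
     = loop_scale 4 (lie_bracket onsager_B onsager_A)"
  by (simp_all add: onsager_A_def onsager_B_def lie_bracket_def tensor_def coord_scale_def
      loop_scale_def sl2_scale_def sl2_x_def sl2_y_def sl2_z_def sl2_e_def sl2_f_def sl2_h_def
      coord_const_simps algebra_simps)


section \<open>The bases [3021] and [3012]\<close>

text \<open>In both families \<open>\<psi>\<close> is indexed from 1: the element $\psi_{i+1}$ is defined by an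
  expression in \<open>i\<close>, hence the predecessor below.  The value at 0 has no meaning and is not used.
  The suffixes \<open>dd\<close> and \<open>ud\<close> stand for the superscripts down-down and up-down.\<close>

definition A_dd :: "nat \<Rightarrow> 'k::field loop_sl2" where
  "A_dd i = - (sl2_x \<otimes> (coord_t - 1) ^ i)"

definition B_dd :: "nat \<Rightarrow> 'k::field loop_sl2" where
  "B_dd i = (- (sl2_y \<otimes> coord_t) - sl2_z \<otimes> (coord_t - 1)) \<bullet> (coord_t - 1) ^ i"

definition psi_dd :: "nat \<Rightarrow> 'k::field loop_sl2" where
  "psi_dd n = (- (sl2_x \<otimes> 1) - sl2_y \<otimes> coord_t) \<bullet> (coord_t - 1) ^ (n - 1)"

definition A_ud :: "nat \<Rightarrow> 'k::field loop_sl2" where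
  "A_ud i = sl2_x \<otimes> (- coord_t) ^ i"

definition B_ud :: "nat \<Rightarrow> 'k::field loop_sl2" where
  "B_ud i = (- (sl2_y \<otimes> coord_t) - sl2_z \<otimes> (coord_t - 1)) \<bullet> (- coord_t) ^ i"

definition psi_ud :: "nat \<Rightarrow> 'k::field loop_sl2" where
  "psi_ud n = (sl2_x \<otimes> 1 - sl2_z \<otimes> (coord_t - 1)) \<bullet> (- coord_t) ^ (n - 1)"

text \<open>\<open>Ix_psi i\<close> indexes the element $\psi_{i+1}$.\<close>

datatype onsager_index = Ix_A nat | Ix_B nat | Ix_psi nat

primrec basis_3021 :: "onsager_index \<Rightarrow> 'k::field loop_sl2" where
  "basis_3021 (Ix_A i) = A_dd i"
| "basis_3021 (Ix_B i) = B_dd i"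
| "basis_3021 (Ix_psi i) = psi_dd (i + 1)"

primrec basis_3012 :: "onsager_index \<Rightarrow> 'k::field loop_sl2" where
  "basis_3012 (Ix_A i) = A_ud i"
| "basis_3012 (Ix_B i) = B_ud i"
| "basis_3012 (Ix_psi i) = psi_ud (i + 1)"

definition is_basis :: "('i \<Rightarrow> 'k::field loop_sl2) \<Rightarrow> 'k loop_sl2 set \<Rightarrow> bool" where
  "is_basis b V \<longleftrightarrow> inj b \<and> \<not> loop.dependent (range b) \<and> loop.span (range b) = V"

end

theory Submission
  imports Defs
begin

text \<open>
  Put \<open>X = x \<otimes> 1\<close>, \<open>Y = y \<otimes> t\<close>, \<open>Z = z \<otimes> (t - 1)\<close>.  The brackets
  \<open>[X, Y] = 2 t X + 2 Y\<close>, \<open>[Y, Z] = 2 (t - 1) Y + 2 t Z\<close>, \<open>[Z, X] = 2 Z + 2 (t - 1) X\<close>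
  show that the free \<open>F[t]\<close>-module on \<open>X, Y, Z\<close> is a Lie subalgebra, and, by induction on the power
  of \<open>t\<close>, that \<open>A = X\<close> and \<open>B = Y + Z\<close> generate all of it; so it is \<open>O\<close>.  Each of the two families
  is the image of the monomial basis of \<open>F[t]^3\<close> under an affine substitution for \<open>t\<close> followed by a
  constant invertible change of the frame \<open>X, Y, Z\<close>, hence a basis of \<open>O\<close>.  The transition formulas
  are the binomial theorem for \<open>-t = -(1 + (t - 1))\<close> and \<open>t - 1 = -(1 + (-t))\<close>.
\<close>

section \<open>Polynomials inside the coordinate algebra\<close>

text \<open>The embedding of F[t] in the coordinate algebra. Being injective, it reduces questions
  about frame coordinates to cancellation in a polynomial ring.\<close>

definition coord_poly :: "'k::field poly \<Rightarrow> 'k coord_alg" where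
  "coord_poly p = Abs_coord_alg (to_fract p)"

lemma Rep_coord_poly: "Rep_coord_alg (coord_poly p) = to_fract p"
  by (simp add: coord_poly_def Abs_coord_alg_inverse to_fract_in_coord_carrier)

lemma coord_poly_eq_iff [simp]: "coord_poly p = coord_poly q \<longleftrightarrow> p = q"
  by (simp add: Rep_coord_alg_inject[symmetric] Rep_coord_poly)

lemma coord_poly_simps [simp]:
  "coord_poly 0 = 0"
  "coord_poly 1 = 1"
  "coord_poly (p + q) = coord_poly p + coord_poly q"
  "coord_poly (p - q) = coord_poly p - coord_poly q"
  "coord_poly (- p) = - coord_poly p"
  "coord_poly (p * q) = coord_poly p * coord_poly q"
  by (simp_all add: Rep_coord_alg_inject[symmetric] Rep_coord_poly zero_coord_alg.rep_eq
      one_coord_alg.rep_eq plus_coord_alg.rep_eq minus_coord_alg.rep_eq uminus_coord_alg.rep_eq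
      times_coord_alg.rep_eq)

lemma coord_poly_power [simp]: "coord_poly (p ^ n) = coord_poly p ^ n"
  by (induction n) simp_all

lemma coord_poly_const: "coord_poly [:c:] = coord_const c"
  by (simp add: Rep_coord_alg_inject[symmetric] Rep_coord_poly coord_const.rep_eq)

lemma coord_poly_numeral [simp]: "coord_poly (numeral n) = numeral n"
  by (simp add: numeral_poly coord_poly_const coord_const_numeral)

lemma coord_poly_X: "coord_poly [:0, 1:] = coord_t"
  by (simp add: Rep_coord_alg_inject[symmetric] Rep_coord_poly coord_t.rep_eq)

lemma pcompose_monom_1: "pcompose (monom 1 n) p = p ^ n"
  for p :: "'a::comm_ring_1 poly"
  by (induction n) (simp_all add: monom_Suc pcompose_pCons pcompose_1)


section \<open>The monomial basis of the free module of rank three\<close>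

text \<open>Triples of polynomials will be coordinates in the frame X, Y, Z, not in e, f, h. The
  field acts through constant polynomials.\<close>

global_interpretation poly_sl2: vector_space "\<lambda>c :: 'k::field. sl2_scale [:c:]"
  by standard (simp_all add: sl2_scale_def plus_sl2_def algebra_simps smult_add_left smult_add_right)

primrec monom_basis :: "onsager_index \<Rightarrow> 'k::field poly sl2" where
  "monom_basis (Ix_A i) = SL2 (monom 1 i) 0 0"
| "monom_basis (Ix_B i) = SL2 0 (monom 1 i) 0"
| "monom_basis (Ix_psi i) = SL2 0 0 (monom 1 i)"

primrec monom_coeff :: "onsager_index \<Rightarrow> 'k::field poly sl2 \<Rightarrow> 'k" where
  "monom_coeff (Ix_A i) v = coeff (e_coord v) i"
| "monom_coeff (Ix_B i) v = coeff (f_coord v) i"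
| "monom_coeff (Ix_psi i) v = coeff (h_coord v) i"

lemma monom_coeff_basis: "monom_coeff i (monom_basis j) = (if i = j then 1 else 0)"
  by (cases i; cases j) simp_all

lemma monom_coeff_0: "monom_coeff i 0 = 0"
  by (cases i) simp_all

lemma monom_coeff_add: "monom_coeff i (u + v) = monom_coeff i u + monom_coeff i v"
  by (cases i) simp_all

lemma monom_coeff_scale: "monom_coeff i (sl2_scale [:c:] v) = c * monom_coeff i v"
  by (cases i) (simp_all add: sl2_scale_def)

lemma monom_coeff_sum: "monom_coeff i (sum g S) = (\<Sum>s\<in>S. monom_coeff i (g s))"
  by (induction S rule: infinite_finite_induct) (simp_all add: monom_coeff_0 monom_coeff_add)

lemma inj_monom_basis: "inj (monom_basis :: onsager_index \<Rightarrow> 'k::field poly sl2)"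
  by (rule injI) (metis monom_coeff_basis zero_neq_one)

lemma independent_monom_basis:
  "\<not> poly_sl2.dependent (range (monom_basis :: onsager_index \<Rightarrow> 'k::field poly sl2))"
proof
  assume "poly_sl2.dependent (range (monom_basis :: onsager_index \<Rightarrow> 'k poly sl2))"
  then obtain S :: "'k poly sl2 set" and u w where S: "finite S" "S \<subseteq> range monom_basis"
    and sum: "(\<Sum>v\<in>S. sl2_scale [:u v:] v) = 0" and w: "w \<in> S" "u w \<noteq> 0"
    unfolding poly_sl2.dependent_explicit by blast
  from w S obtain i where i: "w = monom_basis i"
    by blast
  \<comment> \<open>The functional \<open>monom_coeff i\<close> is dual to \<open>w\<close>, so it
    isolates the coefficient \<open>u w\<close> in the vanishing combination.\<close>
  have "0 = (\<Sum>v\<in>S. u v * monom_coeff i v)"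
    using arg_cong[OF sum, of "monom_coeff i"]
    by (simp add: monom_coeff_sum monom_coeff_scale monom_coeff_0)
  also have "\<dots> = (\<Sum>v\<in>S. if v = w then u v else 0)"
  proof (rule sum.cong)
    fix v assume "v \<in> S"
    with S(2) obtain j where "v = monom_basis j"
      by blast
    then show "u v * monom_coeff i v = (if v = w then u v else 0)"
      by (simp add: i monom_coeff_basis inj_eq[OF inj_monom_basis])
  qed simp
  also have "\<dots> = u w"
    using S(1) w(1) by simp
  finally show False
    using w(2) by simp
qed

text \<open>Each polynomial is the sum of its monomials, so the span contains the three axes, and
  every triple is a sum of one vector from each axis.\<close>

lemma span_monom_basis:
  "poly_sl2.span (range (monom_basis :: onsager_index \<Rightarrow> 'k::field poly sl2)) = UNIV"
proof -
  let ?S = "poly_sl2.span (range (monom_basis :: onsager_index \<Rightarrow> 'k poly sl2))"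
  have gen: "sl2_scale [:c:] (monom_basis i) \<in> ?S" for c i
    by (intro poly_sl2.span_scale poly_sl2.span_base) simp
  have e: "SL2 (monom c i) 0 0 \<in> ?S" and f: "SL2 0 (monom c i) 0 \<in> ?S"
    and h: "SL2 0 0 (monom c i) \<in> ?S" for c i
    using gen[of c "Ix_A i"] gen[of c "Ix_B i"] gen[of c "Ix_psi i"]
    by (simp_all add: sl2_scale_def smult_monom)
  have "SL2 (\<Sum>i\<le>n. monom (c i) i) 0 0 \<in> ?S \<and> SL2 0 (\<Sum>i\<le>n. monom (c i) i) 0 \<in> ?S
      \<and> SL2 0 0 (\<Sum>i\<le>n. monom (c i) i) \<in> ?S" for c n
  proof (induction n)
    case 0
    show ?case by (simp add: e f h)
  next
    case (Suc n)
    then show ?case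
      using poly_sl2.span_add[OF _ e[of "c (Suc n)" "Suc n"]]
        poly_sl2.span_add[OF _ f[of "c (Suc n)" "Suc n"]]
        poly_sl2.span_add[OF _ h[of "c (Suc n)" "Suc n"]]
      by (fastforce simp: plus_sl2_def)
  qed
  from this[of "coeff p" "degree p" for p]
  have "SL2 p 0 0 \<in> ?S" "SL2 0 p 0 \<in> ?S" "SL2 0 0 p \<in> ?S" for p
    by (simp_all add: poly_as_sum_of_monoms)
  then have "SL2 p 0 0 + SL2 0 q 0 + SL2 0 0 r \<in> ?S" for p q r
    by (intro poly_sl2.span_add)
  then have "SL2 p q r \<in> ?S" for p q r
    by (simp add: plus_sl2_def)
  then show ?thesis
    by (metis UNIV_eq_I sl2.exhaust)
qed

text \<open>Injectivity carries independence over, and the monomials span the whole domain, so their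
  images span the range.\<close>

lemma is_basis_image_monom_basis:
  fixes g :: "'k::field poly sl2 \<Rightarrow> 'k loop_sl2"
  assumes lin: "Vector_Spaces.linear (\<lambda>c. sl2_scale [:c:]) loop_scale g"
    and inj: "inj g" and b: "\<And>i. b i = g (monom_basis i)"
  shows "is_basis b (range g)"
proof -
  interpret g: Vector_Spaces.linear "\<lambda>c :: 'k. sl2_scale [:c:]" loop_scale g
    by (rule lin)
  have range_b: "range b = g ` range monom_basis"
    using b by (auto simp: image_image)
  have "inj b"
    using inj_monom_basis inj by (auto simp: inj_def b)
  moreover have "\<not> loop.dependent (range b)"
    unfolding range_b
    using g.independent_inj_image[OF independent_monom_basis inj] .
  moreover have "loop.span (range b) = range g"
    unfolding range_b g.span_image span_monom_basis ..
  ultimately show ?thesis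
    by (simp add: is_basis_def)
qed


section \<open>The Onsager algebra as a free module of rank three\<close>

lemma right_act_left_simps:
  "(u + v) \<bullet> a = u \<bullet> a + v \<bullet> a"
  "(u - v) \<bullet> a = u \<bullet> a - v \<bullet> a"
  "(- v) \<bullet> a = - (v \<bullet> a)"
  by (simp_all add: right_act_def plus_sl2_def minus_sl2_def uminus_sl2_def algebra_simps)

lemma right_act_right_simps:
  "v \<bullet> 0 = 0"
  "v \<bullet> 1 = v"
  "v \<bullet> (a + b) = v \<bullet> a + v \<bullet> b"
  "v \<bullet> (a - b) = v \<bullet> a - v \<bullet> b"
  "v \<bullet> (- a) = - (v \<bullet> a)"
  by (simp_all add: right_act_def zero_sl2_def plus_sl2_def minus_sl2_def uminus_sl2_def
      algebra_simps)

definition frame_X :: "'k::field loop_sl2" where "frame_X = sl2_x \<otimes> 1"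
definition frame_Y :: "'k::field loop_sl2" where "frame_Y = sl2_y \<otimes> coord_t"
definition frame_Z :: "'k::field loop_sl2" where "frame_Z = sl2_z \<otimes> (coord_t - 1)"

definition frame_map :: "'k::field poly sl2 \<Rightarrow> 'k loop_sl2" where
  "frame_map v = frame_X \<bullet> coord_poly (e_coord v) + frame_Y \<bullet> coord_poly (f_coord v)
     + frame_Z \<bullet> coord_poly (h_coord v)"

lemma frame_SL2:
  "frame_X = SL2 2 0 (- 1)"
  "frame_Y = SL2 0 (- 2 * coord_t) (- coord_t)"
  "frame_Z = SL2 0 0 (coord_t - 1)"
  by (simp_all add: frame_X_def frame_Y_def frame_Z_def tensor_def coord_scale_def sl2_scale_def
      sl2_x_def sl2_y_def sl2_z_def sl2_e_def sl2_f_def sl2_h_def coord_const_simps)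

lemma frame_map_SL2:
  "frame_map (SL2 p q r) = SL2 (coord_poly (2 * p)) (coord_poly (- 2 * ([:0, 1:] * q)))
     (coord_poly (- p - [:0, 1:] * q + ([:0, 1:] - 1) * r))"
  by (simp only: frame_map_def frame_SL2 right_act_def plus_sl2_def sl2.sel coord_poly_simps
      coord_poly_X coord_poly_numeral) (simp add: algebra_simps)

lemma linear_frame_map: "Vector_Spaces.linear (\<lambda>c. sl2_scale [:c:]) loop_scale frame_map"
proof unfold_locales
  show "frame_map (u + v) = frame_map u + frame_map v" for u v :: "'a poly sl2"
    by (simp add: frame_map_def right_act_def plus_sl2_def algebra_simps)
  have smult: "coord_poly (smult c p) = coord_const c * coord_poly p" for c :: 'a and p
    using coord_poly_simps(6)[of "[:c:]" p] by (simp add: coord_poly_const)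
  show "frame_map (sl2_scale [:c:] v) = loop_scale c (frame_map v)" for c and v :: "'a poly sl2"
    by (simp add: frame_map_def loop_scale_def sl2_scale_def right_act_def plus_sl2_def smult
        algebra_simps)
qed

text \<open>In coordinates e, f, h the frame is triangular with diagonal 2, -2t, t - 1. These are
  nonzero polynomials in characteristic zero and can be cancelled.\<close>

lemma inj_frame_map: "inj (frame_map :: 'k::field_char_0 poly sl2 \<Rightarrow> 'k loop_sl2)"
proof (rule injI)
  fix u v :: "'k poly sl2"
  assume eq: "frame_map u = frame_map v"
  obtain p q r p' q' r' where u: "u = SL2 p q r" and v: "v = SL2 p' q' r'"
    by (metis sl2.exhaust)
  from eq have "2 * p = 2 * p'" "- 2 * ([:0, 1:] * q) = - 2 * ([:0, 1:] * q')"
    and h: "- p - [:0, 1:] * q + ([:0, 1:] - 1) * r = - p' - [:0, 1:] * q' + ([:0, 1:] - 1) * r'"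
    unfolding u v frame_map_SL2 sl2.inject coord_poly_eq_iff by blast+
  then have "p = p'" "q = q'"
    by (simp_all only: mult_cancel_left) auto
  moreover have "[:0, 1:] - 1 \<noteq> (0 :: 'k poly)"
    by (simp add: one_pCons)
  with h \<open>p = p'\<close> \<open>q = q'\<close> have "r = r'"
    by (simp only: add_left_cancel mult_cancel_left simp_thms)
  ultimately show "u = v"
    by (simp add: u v)
qed

text \<open>The 2x2 minors of the two coefficient triples multiply the brackets [X, Y], [Y, Z],
  [Z, X]. The coefficients stay polynomial, which gives closure under the bracket.\<close>

lemma frame_map_bracket:
  "lie_bracket (frame_map (SL2 p q r)) (frame_map (SL2 p' q' r')) =
    frame_map (SL2
      (2 * [:0, 1:] * (p * q' - q * p') + 2 * ([:0, 1:] - 1) * (r * p' - p * r'))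
      (2 * (p * q' - q * p') + 2 * ([:0, 1:] - 1) * (q * r' - r * q'))
      (2 * [:0, 1:] * (q * r' - r * q') + 2 * (r * p' - p * r')))"
  unfolding frame_map_SL2 lie_bracket_def sl2.sel
  by (simp only: coord_poly_simps coord_poly_X coord_poly_numeral sl2.inject) (simp add: algebra_simps)

lemma onsager_generators_frame: "onsager_A = frame_X" "onsager_B = frame_Y + frame_Z"
  by (simp_all add: onsager_A_def onsager_B_def frame_X_def frame_Y_def frame_Z_def)

lemma lie_subalgebra_range_frame_map: "lie_subalgebra (range frame_map)"
proof -
  interpret frame: Vector_Spaces.linear "\<lambda>c. sl2_scale [:c:]" loop_scale frame_map
    by (rule linear_frame_map)
  have "lie_bracket (frame_map u) (frame_map v) \<in> range frame_map" for u v :: "'a poly sl2"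
    by (metis frame_map_bracket rangeI sl2.exhaust)
  then show ?thesis
    unfolding lie_subalgebra_def
    using frame.subspace_image[OF poly_sl2.subspace_UNIV] by auto
qed

section \<open>Generation of the frame module by A and B\<close>

lemma frame_brackets:
  fixes a b :: "'k::field coord_alg"
  shows "lie_bracket (frame_X \<bullet> a) (frame_Y \<bullet> b)
      = loop_scale 2 (frame_X \<bullet> (coord_t * (a * b)) + frame_Y \<bullet> (a * b))"
    and "lie_bracket (frame_Y \<bullet> a) (frame_Z \<bullet> b)
      = loop_scale 2 (frame_Y \<bullet> (coord_t * (a * b)) - frame_Y \<bullet> (a * b)
          + frame_Z \<bullet> (coord_t * (a * b)))"
    and "lie_bracket (frame_X \<bullet> a) (frame_Y + frame_Z)
      = loop_scale 2 (frame_X \<bullet> a + frame_Y \<bullet> a - frame_Z \<bullet> a)"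
  by (simp_all add: frame_SL2 lie_bracket_def right_act_def loop_scale_def sl2_scale_def
      plus_sl2_def minus_sl2_def coord_const_simps algebra_simps)

lemma frame_power_in_onsager:
  "frame_X \<bullet> coord_t ^ n \<in> (onsager :: 'k::field_char_0 loop_sl2 set)
    \<and> frame_Y \<bullet> coord_t ^ n \<in> (onsager :: 'k loop_sl2 set)
    \<and> frame_Z \<bullet> coord_t ^ n \<in> (onsager :: 'k loop_sl2 set)"
proof -
  let ?O = "onsager :: 'k loop_sl2 set"
  have sub: "loop.subspace ?O"
    using lie_subalgebra_onsager by (auto simp: lie_subalgebra_def)
  have br: "lie_bracket u v \<in> ?O" if "u \<in> ?O" "v \<in> ?O" for u v
    using lie_subalgebra_onsager that by (auto simp: lie_subalgebra_def)
  have "{onsager_A, onsager_B} \<subseteq> ?O"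
    unfolding onsager_def by (rule hull_subset)
  then have A: "frame_X \<in> ?O" and B: "frame_Y + frame_Z \<in> ?O"
    by (auto simp: onsager_generators_frame)
  \<comment> \<open>The brackets all produce a factor 2, which characteristic zero allows to be
    removed.\<close>
  have halve: "v \<in> ?O" if "loop_scale 2 v \<in> ?O" for v
    using loop.subspace_scale[OF sub that, of "1 / 2"] by simp
  note add = loop.subspace_add[OF sub] and diff = loop.subspace_diff[OF sub]
  note one = right_act_right_simps(2)
  \<comment> \<open>Bracketing aX with B gives 2(aX + aY - aZ): the terms in t cancel. Removing aX
    and adding aY + aZ leaves 2aY, so the sum separates without a change of degree.\<close>
  have YZ: "frame_Y \<bullet> a \<in> ?O \<and> frame_Z \<bullet> a \<in> ?O"
    if X: "frame_X \<bullet> a \<in> ?O" and sum: "frame_Y \<bullet> a + frame_Z \<bullet> a \<in> ?O" for a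
  proof -
    have "frame_X \<bullet> a + frame_Y \<bullet> a - frame_Z \<bullet> a \<in> ?O"
      by (rule halve) (use br[OF X B] in \<open>simp add: frame_brackets\<close>)
    from add[OF diff[OF this X] sum] have "loop_scale 2 (frame_Y \<bullet> a) \<in> ?O"
      by (simp add: loop.scale_left_distrib[of 1 1, simplified])
    then have "frame_Y \<bullet> a \<in> ?O"
      by (rule halve)
    with diff[OF sum this] show ?thesis
      by simp
  qed
  have Y: "frame_Y \<in> ?O" and Z: "frame_Z \<in> ?O"
    using YZ[of 1] A B by (simp_all add: one)
  show ?thesis
  proof (induction n)
    case 0
    show ?case
      using A Y Z by (simp add: one)
  next
    case (Suc n)
    then have IX: "frame_X \<bullet> coord_t ^ n \<in> ?O" and IY: "frame_Y \<bullet> coord_t ^ n \<in> ?O"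
      by blast+
    \<comment> \<open>Half of [t^n X, Y] raises the power on X; half of [t^n Y, Z], further below,
      raises it on Y + Z. Then \<open>YZ\<close> splits that sum.\<close>
    have "frame_X \<bullet> coord_t ^ Suc n + frame_Y \<bullet> coord_t ^ n \<in> ?O"
      by (rule halve) (use br[OF IX Y] frame_brackets(1)[of "coord_t ^ n" "1 :: 'k coord_alg"] in \<open>simp add: one\<close>)
    from diff[OF this IY] have X: "frame_X \<bullet> coord_t ^ Suc n \<in> ?O"
      by simp
    have "frame_Y \<bullet> coord_t ^ Suc n - frame_Y \<bullet> coord_t ^ n + frame_Z \<bullet> coord_t ^ Suc n \<in> ?O"
      by (rule halve) (use br[OF IY Z] frame_brackets(2)[of "coord_t ^ n" "1 :: 'k coord_alg"] in \<open>simp add: one\<close>)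
    from add[OF this IY] have "frame_Y \<bullet> coord_t ^ Suc n + frame_Z \<bullet> coord_t ^ Suc n \<in> ?O"
      by simp
    from YZ[OF X this] X show ?case
      by blast
  qed
qed

lemma frame_map_monom_basis_in_onsager:
  "frame_map (monom_basis i) \<in> (onsager :: 'k::field_char_0 loop_sl2 set)"
proof -
  have "coord_poly (monom 1 n) = (coord_t ^ n :: 'k coord_alg)" for n
    by (simp add: monom_altdef coord_poly_X)
  then show ?thesis
    by (cases i) (simp_all add: frame_map_def right_act_right_simps frame_power_in_onsager)
qed

text \<open>The range is spanned by the monomial multiples of X, Y, Z, which lie in
  \<open>onsager\<close>. Conversely it is a Lie subalgebra containing both generators, so
  minimality of the hull applies.\<close>

lemma range_frame_map: "range frame_map = (onsager :: 'k::field_char_0 loop_sl2 set)"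
proof
  interpret frame: Vector_Spaces.linear "\<lambda>c :: 'k. sl2_scale [:c:]" loop_scale frame_map
    by (rule linear_frame_map)
  have "range frame_map = loop.span (frame_map ` range (monom_basis :: _ \<Rightarrow> 'k poly sl2))"
    unfolding frame.span_image span_monom_basis ..
  also have "\<dots> \<subseteq> onsager"
    using lie_subalgebra_onsager frame_map_monom_basis_in_onsager
    by (intro loop.span_minimal) (auto simp: lie_subalgebra_def)
  finally show "range frame_map \<subseteq> (onsager :: 'k loop_sl2 set)" .
  have "frame_map (SL2 1 0 0) = (onsager_A :: 'k loop_sl2)"
    "frame_map (SL2 0 1 1) = (onsager_B :: 'k loop_sl2)"
    by (simp_all add: frame_map_def onsager_generators_frame right_act_right_simps)
  then have "onsager_A \<in> range (frame_map :: _ \<Rightarrow> 'k loop_sl2)"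
    "onsager_B \<in> range (frame_map :: _ \<Rightarrow> 'k loop_sl2)"
    by (metis rangeI)+
  then show "(onsager :: 'k loop_sl2 set) \<subseteq> range frame_map"
    unfolding onsager_def
    by (intro hull_minimal lie_subalgebra_range_frame_map) auto
qed

text \<open>Linearity of \<open>g\<close> is asked only over the field, because a substitution for t
  is not F[t]-linear.\<close>

lemma is_basis_onsager:
  fixes g :: "'k::field_char_0 poly sl2 \<Rightarrow> 'k poly sl2"
  assumes add: "\<And>u v. g (u + v) = g u + g v"
    and scale: "\<And>c v. g (sl2_scale [:c:] v) = sl2_scale [:c:] (g v)"
    and inv: "\<And>v. g' (g v) = v" "\<And>v. g (g' v) = v"
    and b: "\<And>i. b i = frame_map (g (monom_basis i))"
  shows "is_basis b onsager"
proof -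
  have "bij g"
    using inv by (metis bijI')
  have "Vector_Spaces.linear (\<lambda>c. sl2_scale [:c:]) (\<lambda>c. sl2_scale [:c:]) g"
    by unfold_locales (simp_all add: add scale)
  then have "Vector_Spaces.linear (\<lambda>c. sl2_scale [:c:]) loop_scale (frame_map \<circ> g)"
    by (rule Vector_Spaces.linear_compose[OF _ linear_frame_map])
  moreover have "inj (frame_map \<circ> g)"
    using inj_frame_map \<open>bij g\<close> by (intro inj_compose) (auto simp: bij_def)
  moreover have "range (frame_map \<circ> g) = onsager"
    using \<open>bij g\<close> range_frame_map by (metis bij_is_surj image_comp)
  ultimately show ?thesis
    using is_basis_image_monom_basis[of "frame_map \<circ> g" b] b by simp
qed

section \<open>The two families in frame coordinates\<close>

lemma family_frame_dd:
  "A_dd i = (- frame_X) \<bullet> (coord_t - 1) ^ i"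
  "B_dd i = (- frame_Y - frame_Z) \<bullet> (coord_t - 1) ^ i"
  "psi_dd (Suc i) = (- frame_X - frame_Y) \<bullet> (coord_t - 1) ^ i"
  by (simp_all add: A_dd_def B_dd_def psi_dd_def frame_X_def frame_Y_def frame_Z_def
      right_act_left_simps(3) right_act_tensor)

lemma family_frame_ud:
  "A_ud i = frame_X \<bullet> (- coord_t) ^ i"
  "B_ud i = (- frame_Y - frame_Z) \<bullet> (- coord_t) ^ i"
  "psi_ud (Suc i) = (frame_X - frame_Z) \<bullet> (- coord_t) ^ i"
  by (simp_all add: A_ud_def B_ud_def psi_ud_def frame_X_def frame_Y_def frame_Z_def
      right_act_tensor)

text \<open>\<open>coords_3021\<close> sends a coefficient vector with respect to [3021], read as three polynomials in
  \<open>t - 1\<close>, to its coordinates in the frame; likewise \<open>coords_3012\<close> with polynomials in \<open>-t\<close>.\<close>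

definition coords_3021 :: "'k::field poly sl2 \<Rightarrow> 'k poly sl2" where
  "coords_3021 v = SL2 (pcompose (- e_coord v - h_coord v) [:- 1, 1:])
     (pcompose (- f_coord v - h_coord v) [:- 1, 1:]) (pcompose (- f_coord v) [:- 1, 1:])"

text \<open>Solving p = -a - c, q = -b - c, r = -b gives a = q - p - r, b = -r, c = r - q.
  Substituting t + 1 undoes t - 1.\<close>

definition coords_3021_inv :: "'k::field poly sl2 \<Rightarrow> 'k poly sl2" where
  "coords_3021_inv v = SL2 (pcompose (f_coord v - e_coord v - h_coord v) [:1, 1:])
     (pcompose (- h_coord v) [:1, 1:]) (pcompose (h_coord v - f_coord v) [:1, 1:])"

definition coords_3012 :: "'k::field poly sl2 \<Rightarrow> 'k poly sl2" where
  "coords_3012 v = SL2 (pcompose (e_coord v + h_coord v) [:0, - 1:])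
     (pcompose (- f_coord v) [:0, - 1:]) (pcompose (- f_coord v - h_coord v) [:0, - 1:])"

text \<open>Solving p = a + c, q = -b, r = -b - c gives a = p - q + r, b = -q, c = q - r. The
  substitution of -t is an involution.\<close>

definition coords_3012_inv :: "'k::field poly sl2 \<Rightarrow> 'k poly sl2" where
  "coords_3012_inv v = SL2 (pcompose (e_coord v - f_coord v + h_coord v) [:0, - 1:])
     (pcompose (- f_coord v) [:0, - 1:]) (pcompose (f_coord v - h_coord v) [:0, - 1:])"

lemma pcompose_affine_inverse:
  "pcompose (pcompose p [:- 1, 1:]) [:1, 1:] = (p :: 'k::field poly)"
  "pcompose (pcompose p [:1, 1:]) [:- 1, 1:] = p"
  "pcompose (pcompose p [:0, - 1:]) [:0, - 1:] = p"
  by (simp_all add: pcompose_assoc[symmetric] pcompose_pCons pcompose_idR)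

lemma coord_poly_affine:
  "coord_poly [:- 1, 1:] = coord_t - 1" "coord_poly [:0, - 1:] = - coord_t"
  by (simp_all flip: coord_poly_X coord_poly_simps add: one_pCons)

lemma is_basis_3021: "is_basis basis_3021 (onsager :: 'k::field_char_0 loop_sl2 set)"
proof (rule is_basis_onsager[of coords_3021 coords_3021_inv])
  show "basis_3021 i = frame_map (coords_3021 (monom_basis i :: 'k poly sl2))" for i
    by (cases i) (simp_all add: family_frame_dd frame_map_def coords_3021_def
        pcompose_monom_1 pcompose_add pcompose_diff pcompose_uminus coord_poly_affine
        right_act_left_simps right_act_right_simps)
qed (simp_all add: coords_3021_def coords_3021_inv_def sl2_scale_def plus_sl2_def pcompose_add
    pcompose_diff pcompose_uminus pcompose_smult pcompose_affine_inverse smult_diff_right)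

lemma is_basis_3012: "is_basis basis_3012 (onsager :: 'k::field_char_0 loop_sl2 set)"
proof (rule is_basis_onsager[of coords_3012 coords_3012_inv])
  show "basis_3012 i = frame_map (coords_3012 (monom_basis i :: 'k poly sl2))" for i
    by (cases i) (simp_all add: family_frame_ud frame_map_def coords_3012_def
        pcompose_monom_1 pcompose_add pcompose_diff pcompose_uminus coord_poly_affine
        right_act_left_simps right_act_right_simps)
qed (simp_all add: coords_3012_def coords_3012_inv_def sl2_scale_def plus_sl2_def pcompose_add
    pcompose_diff pcompose_uminus pcompose_smult pcompose_affine_inverse smult_diff_right
    smult_add_right)


section \<open>Transition formulas\<close>

lemma right_act_const_mult: "v \<bullet> (coord_const c * a) = loop_scale c (v \<bullet> a)"
  by (simp add: right_act_def loop_scale_def sl2_scale_def algebra_simps)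

lemma right_act_sum_right: "v \<bullet> (\<Sum>j\<in>J. g j) = (\<Sum>j\<in>J. v \<bullet> g j)"
proof (induction J rule: infinite_finite_induct)
  case (insert j J)
  then show ?case by (simp add: right_act_right_simps)
qed (simp_all add: right_act_right_simps)

lemma coord_const_of_nat: "coord_const (of_nat m) = of_nat m"
  by (induction m) (simp_all add: coord_const_hom)

lemma coord_const_power: "coord_const (c ^ n) = coord_const c ^ n"
  by (induction n) (simp_all add: coord_const_hom)

text \<open>The relation a = -(b + 1) is symmetric in a and b and holds between -t and t - 1. Hence
  this one expansion serves both transition matrices.\<close>

lemma right_act_power_binomial:
  fixes v :: "'k::field loop_sl2"
  assumes "a = - (b + 1)"
  shows "v \<bullet> a ^ i
    = loop_scale ((- 1) ^ i) (\<Sum>j=0..i. loop_scale (of_nat (i choose j)) (v \<bullet> b ^ j))"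
proof -
  have "a ^ i = (- 1) ^ i * (b + 1) ^ i"
    unfolding assms by (rule power_minus)
  also have "\<dots> = coord_const ((- 1) ^ i)
      * (\<Sum>j=0..i. coord_const (of_nat (i choose j)) * b ^ j)"
    by (simp add: binomial_ring atMost_atLeast0 coord_const_of_nat coord_const_power
        coord_const_uminus coord_const_hom)
  finally show ?thesis
    by (simp only: right_act_const_mult right_act_sum_right)
qed

theorem lemma11p4:
  shows "is_basis (basis_3021 :: onsager_index \<Rightarrow> 'k::field_char_0 loop_sl2) onsager
    \<and> is_basis (basis_3012 :: onsager_index \<Rightarrow> 'k loop_sl2) onsager
    \<and> (\<forall>i.
        (A_ud i :: 'k loop_sl2)
          = loop_scale ((- 1) ^ (i + 1)) (\<Sum>j=0..i. loop_scale (of_nat (i choose j)) (A_dd j))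
      \<and> (B_ud i :: 'k loop_sl2)
          = loop_scale ((- 1) ^ i) (\<Sum>j=0..i. loop_scale (of_nat (i choose j)) (B_dd j))
      \<and> (psi_ud (i + 1) :: 'k loop_sl2)
          = loop_scale ((- 1) ^ i) (\<Sum>j=0..i. loop_scale (of_nat (i choose j)) (B_dd j))
          + loop_scale ((- 1) ^ (i + 1))
              (\<Sum>j=0..i. loop_scale (of_nat (i choose j)) (psi_dd (j + 1))))
    \<and> (\<forall>i.
        (A_dd i :: 'k loop_sl2)
          = loop_scale ((- 1) ^ (i + 1)) (\<Sum>j=0..i. loop_scale (of_nat (i choose j)) (A_ud j))
      \<and> (B_dd i :: 'k loop_sl2)
          = loop_scale ((- 1) ^ i) (\<Sum>j=0..i. loop_scale (of_nat (i choose j)) (B_ud j))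
      \<and> (psi_dd (i + 1) :: 'k loop_sl2)
          = loop_scale ((- 1) ^ i) (\<Sum>j=0..i. loop_scale (of_nat (i choose j)) (B_ud j))
          + loop_scale ((- 1) ^ (i + 1))
              (\<Sum>j=0..i. loop_scale (of_nat (i choose j)) (psi_ud (j + 1))))"
proof -
  have s: "coord_t - 1 = - (- coord_t + 1 :: 'k coord_alg)"
    and t: "- coord_t = - (coord_t - 1 + 1 :: 'k coord_alg)"
    by simp_all
  note dd = right_act_power_binomial[OF s] and ud = right_act_power_binomial[OF t]
  \<comment> \<open>The additional sign arises because the two A families are built on X and
    -X.\<close>
  have A_ud: "A_ud i = loop_scale ((- 1) ^ (i + 1))
        (\<Sum>j=0..i. loop_scale (of_nat (i choose j)) (A_dd j :: 'k loop_sl2))" for i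
    unfolding family_frame_dd family_frame_ud ud[where v = frame_X]
    by (simp add: right_act_left_simps sum_negf)
  have A_dd: "A_dd i = loop_scale ((- 1) ^ (i + 1))
        (\<Sum>j=0..i. loop_scale (of_nat (i choose j)) (A_ud j :: 'k loop_sl2))" for i
    unfolding family_frame_dd family_frame_ud right_act_left_simps dd[where v = frame_X]
    by simp
  \<comment> \<open>Both B families are built on the same vector -Y - Z, so only the binomial sign
    appears.\<close>
  have B: "B_ud i = loop_scale ((- 1) ^ i)
        (\<Sum>j=0..i. loop_scale (of_nat (i choose j)) (B_dd j :: 'k loop_sl2))"
    "B_dd i = loop_scale ((- 1) ^ i)
        (\<Sum>j=0..i. loop_scale (of_nat (i choose j)) (B_ud j :: 'k loop_sl2))" for i
    unfolding B_ud_def B_dd_def by (rule ud dd)+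
  have psi_ud: "psi_ud (i + 1) = B_ud i + loop_scale ((- 1) ^ (i + 1))
        (\<Sum>j=0..i. loop_scale (of_nat (i choose j)) (psi_dd (j + 1) :: 'k loop_sl2))" for i
  proof -
    \<comment> \<open>The splitting X - Z = (-Y - Z) - (-X - Y) accounts for the B term and for the
      opposite sign of the psi sum.\<close>
    have "psi_ud (i + 1) = B_ud i - (- frame_X - frame_Y) \<bullet> (- coord_t) ^ i"
      by (simp add: family_frame_ud right_act_left_simps)
    also have "(- frame_X - frame_Y) \<bullet> (- coord_t) ^ i = loop_scale ((- 1) ^ i)
        (\<Sum>j=0..i. loop_scale (of_nat (i choose j)) (psi_dd (j + 1) :: 'k loop_sl2))"
      by (simp only: ud[where v = "- frame_X - frame_Y"] family_frame_dd Suc_eq_plus1[symmetric])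
    finally show ?thesis
      by simp
  qed
  have psi_dd: "psi_dd (i + 1) = B_dd i + loop_scale ((- 1) ^ (i + 1))
        (\<Sum>j=0..i. loop_scale (of_nat (i choose j)) (psi_ud (j + 1) :: 'k loop_sl2))" for i
  proof -
    \<comment> \<open>The same relation among the vectors, solved for -X - Y.\<close>
    have "psi_dd (i + 1) = B_dd i - (frame_X - frame_Z) \<bullet> (coord_t - 1) ^ i"
      by (simp add: family_frame_dd right_act_left_simps)
    also have "(frame_X - frame_Z) \<bullet> (coord_t - 1) ^ i = loop_scale ((- 1) ^ i)
        (\<Sum>j=0..i. loop_scale (of_nat (i choose j)) (psi_ud (j + 1) :: 'k loop_sl2))"
      by (simp only: dd[where v = "frame_X - frame_Z"] family_frame_ud Suc_eq_plus1[symmetric])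
    finally show ?thesis
      by simp
  qed
  \<comment> \<open>Expanding the leading B term by \<open>B\<close> turns the psi identities into
    the stated form.\<close>
  show ?thesis
    by (intro conjI allI is_basis_3021 is_basis_3012 A_ud A_dd B
        psi_ud[unfolded B(1)] psi_dd[unfolded B(2)])
qed

end
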